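(* Let $\theta$ be a nonzero real number and $k$ a real number (the Fourier parameter). The Fourier integral of $x^\alpha e^{-\theta^2x^2}$ is $$\int_{-\infty}^{+\infty} x^\alpha e^{-\theta^2x^2}e^{ikx}\,dx=\begin{cases}\dfrac{\Gamma\left(\frac{\alpha+1}{2}\right)}{|\theta|^{\alpha+1}}\,{}_1F_1\left(\dfrac{\alpha+1}{2};\dfrac12;-\dfrac{k^2}{4\theta^2}\right), & \text{if }\alpha>-1\text{ and }\alpha\text{ is even},\\[3mm] i\,\dfrac{\Gamma\left(\frac{\alpha}{2}+1\right)}{\theta^2|\theta|^{\alpha}}\,k\,{}_1F_1\left(\dfrac{\alpha}{2}+1;\dfrac32;-\dfrac{k^2}{4\theta^2}\right), & \text{if }\alpha>-2\text{ and }\alpha\text{ is odd}.\end{cases}$$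
   Context: $\Gamma$ is the gamma function, $i$ the imaginary unit, and ${}_1F_1(a;b;z)=\sum_{n=0}^{\infty}\frac{(a)_n}{(b)_n}\frac{z^n}{n!}$ with Pochhammer symbol $(\vartheta)_n=\Gamma(\vartheta+n)/\Gamma(\vartheta)$, $(\vartheta)_0=1$.
   Formalization: For α = −1 the integral does not converge at x = 0 (the real part behaves like 1/x), so in this case it is taken as a Cauchy principal value at 0; for all other even or odd integers α in the stated ranges it is the ordinary absolutely convergent integral. *)

theory Defs
  imports "HOL-Analysis.Analysis"
begin

definition hyp1F1 :: "'a \<Rightarrow> 'a \<Rightarrow> 'a \<Rightarrow> 'a::{real_normed_field,banach}" where
  "hyp1F1 a b z = (\<Sum>n. pochhammer a n / pochhammer b n * (z ^ n / fact n))"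

text \<open>
  The integral over the real line with a symmetric neighbourhood of the possible singularity
  at 0 cut out (Cauchy principal value). If \<open>f\<close> is Lebesgue integrable, this is the
  ordinary integral.
\<close>

definition has_pv_integral :: "(real \<Rightarrow> complex) \<Rightarrow> complex \<Rightarrow> bool" where
  "has_pv_integral f I \<longleftrightarrow>
     (\<forall>\<epsilon>>0. set_integrable lborel {x. \<epsilon> \<le> \<bar>x\<bar>} f) \<and>
     ((\<lambda>\<epsilon>. LINT x:{x. \<epsilon> \<le> \<bar>x\<bar>}|lborel. f x) \<longlongrightarrow> I) (at_right 0)"

definition fourier_integrand :: "int \<Rightarrow> real \<Rightarrow> real \<Rightarrow> real \<Rightarrow> complex" where
  "fourier_integrand \<alpha> \<theta> k x =
     of_real (x powi \<alpha> * exp (- \<theta>\<^sup>2 * x\<^sup>2)) * exp (\<i> * of_real k * of_real x)"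

end

theory Submission
  imports Defs "HOL-Probability.Distributions"
begin

text \<open>
  Expand \<open>e\<^sup>i\<^sup>k\<^sup>x\<close> in powers of \<open>x\<close> and integrate term by term against the Gaussian weight. This is
  legitimate because the partial sums are dominated by \<open>e\<^sup>|\<^sup>k\<^sup>x\<^sup>|\<close>, which costs only half of the
  Gaussian decay: \<open>|kx| \<le> \<theta>\<^sup>2x\<^sup>2/2 + k\<^sup>2/(2\<theta>\<^sup>2)\<close>. Odd moments of the Gaussian vanish and the even moment
  of order \<open>2(p+j)\<close> is \<open>\<Gamma>(p+j+1/2)/|\<theta>|^(2p+2j+1)\<close>, so that only the coefficients with even index
  survive. The quotient \<open>\<Gamma>(p+j+1/2)/\<Gamma>(p+1/2)\<close> is the Pochhammer symbol in the numerator of the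
  hypergeometric series; the one in the denominator comes from the factorials, since
  \<open>(2j)! = 4^j (1/2)\<^sub>j j!\<close> and \<open>(2j+1)! = 4^j (3/2)\<^sub>j j!\<close>. This computation is
  \<open>gaussian_integral_eq_hyp1F1\<close>.

  For odd \<open>\<alpha> = 2p - 1\<close> the same computation would start from the power \<open>x\<^sup>-\<^sup>1\<close> when \<open>p = 0\<close>. Splitting
  \<open>x^(2p-1) e\<^sup>i\<^sup>k\<^sup>x = x^(2p) (e\<^sup>i\<^sup>k\<^sup>x - 1)/x + x^(2p-1)\<close> treats all \<open>p \<ge> 0\<close> at once: the first summand is an
  even power of \<open>x\<close> times an entire function, and the second one is odd, so that it contributes nothing to
  the integral over a symmetric set. For \<open>p > 0\<close> the second summand is integrable; for
  \<open>p = 0\<close> it carries the whole singularity, and cutting out a symmetric neighbourhood of \<open>0\<close> removes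
  its contribution (\<open>has_pv_integral_add_odd\<close>).
\<close>

section \<open>Moments of the Gaussian weight\<close>

text \<open>The standard half-line moments, doubled by symmetry and rescaled by \<open>x \<mapsto> |\<theta>| x\<close>.\<close>
lemma gaussian_moment_even:
  fixes \<theta> :: real
  assumes "\<theta> \<noteq> 0"
  shows "has_bochner_integral lborel (\<lambda>x. x ^ (2 * j) * exp (- \<theta>\<^sup>2 * x\<^sup>2))
           (Gamma (of_nat j + 1 / 2) / \<bar>\<theta>\<bar> ^ (2 * j + 1))"
proof -
  have "(1 / 2 :: real) \<notin> \<int>\<^sub>\<le>\<^sub>0"
    by (auto elim!: nonpos_Ints_cases)
  then have Gamma_half: "Gamma (of_nat j + 1 / 2) = sqrt pi * (fact (2 * j) / (2 ^ (2 * j) * fact j))"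
    using pochhammer_Gamma[of "1/2 :: real" j]
    by (simp add: fact_double[of j, where 'a = real] Gamma_one_half_real add.commute)
  have "has_bochner_integral lborel (\<lambda>x::real. exp (- x\<^sup>2) * x ^ (2 * j)) (Gamma (of_nat j + 1 / 2))"
    using has_bochner_integral_even_function[OF gaussian_moment_even_pos[where k = j]]
    by (simp add: Gamma_half)
  then have "has_bochner_integral lborel
      (\<lambda>x. exp (- (0 + \<bar>\<theta>\<bar> * x)\<^sup>2) * (0 + \<bar>\<theta>\<bar> * x) ^ (2 * j))
      (Gamma (of_nat j + 1 / 2) /\<^sub>R \<bar>\<bar>\<theta>\<bar>\<bar>)"
    by (rule iffD1[OF lborel_has_bochner_integral_real_affine_iff, rotated]) (use assms in simp)
  then have "has_bochner_integral lborel (\<lambda>x. exp (- (\<bar>\<theta>\<bar> * x)\<^sup>2) * (\<bar>\<theta>\<bar> * x) ^ (2 * j))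
      (Gamma (of_nat j + 1 / 2) / \<bar>\<theta>\<bar>)"
    by (simp only: add_0 abs_abs real_scaleR_def divide_inverse_commute)
  then have "has_bochner_integral lborel
      (\<lambda>x. exp (- (\<bar>\<theta>\<bar> * x)\<^sup>2) * (\<bar>\<theta>\<bar> * x) ^ (2 * j) / \<bar>\<theta>\<bar> ^ (2 * j))
      (Gamma (of_nat j + 1 / 2) / \<bar>\<theta>\<bar> / \<bar>\<theta>\<bar> ^ (2 * j))"
    by (rule has_bochner_integral_divide_zero)
  then show ?thesis
    using assms by (simp add: power_mult_distrib mult_ac)
qed

lemma integral_odd_eq_0:
  fixes f :: "real \<Rightarrow> 'a :: {banach, second_countable_topology}"
  assumes "\<And>x. f (- x) = - f x"
  shows "integral\<^sup>L lborel f = 0"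
proof -
  have "integral\<^sup>L lborel f = - integral\<^sup>L lborel f"
    using lborel_integral_real_affine[of "-1" f 0] assms by simp
  then have "2 *\<^sub>R integral\<^sup>L lborel f = 0"
    unfolding scaleR_2 by (metis add.left_inverse)
  then show ?thesis by simp
qed

text \<open>Comparison with the moments of order \<open>0\<close> and \<open>2m\<close>, by \<open>2|x|^m \<le> 1 + |x|^(2m)\<close>.\<close>
lemma integrable_gaussian_abs_moment:
  fixes \<theta> :: real
  assumes "\<theta> \<noteq> 0"
  shows "integrable lborel (\<lambda>x. \<bar>x\<bar> ^ m * exp (- \<theta>\<^sup>2 * x\<^sup>2))"
proof (rule Bochner_Integration.integrable_bound)
  show "integrable lborel (\<lambda>x::real. x ^ (2 * 0) * exp (- \<theta>\<^sup>2 * x\<^sup>2) + x ^ (2 * m) * exp (- \<theta>\<^sup>2 * x\<^sup>2))"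
    by (intro Bochner_Integration.integrable_add integrable.intros[OF gaussian_moment_even] assms)
  have "\<bar>x\<bar> ^ m \<le> 1 + x ^ (2 * m)" for x :: real
    using sum_squares_bound[of 1 "\<bar>x\<bar> ^ m"] zero_le_power[OF abs_ge_zero, of x m]
    by (simp add: power2_eq_square power_mult_distrib[symmetric] power_mult del: zero_le_power zero_le_power_abs)
  then have "\<bar>x\<bar> ^ m * exp (- \<theta>\<^sup>2 * x\<^sup>2) \<le> (1 + x ^ (2 * m)) * exp (- \<theta>\<^sup>2 * x\<^sup>2)" for x :: real
    by (intro mult_right_mono) auto
  then show "AE x in lborel. norm (\<bar>x\<bar> ^ m * exp (- \<theta>\<^sup>2 * x\<^sup>2))
      \<le> norm (x ^ (2 * 0) * exp (- \<theta>\<^sup>2 * x\<^sup>2) + x ^ (2 * m) * exp (- \<theta>\<^sup>2 * x\<^sup>2))"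
    by (intro AE_I2) (simp add: abs_mult distrib_right)
qed auto

section \<open>Term-by-term integration of power series\<close>

text \<open>
  Completing the square: half of the Gaussian exponent, the Gaussian with parameter \<open>\<theta>/\<surd>2\<close>, remains
  after a linear exponent has been absorbed.
\<close>
lemma linear_le_gaussian_exponent:
  fixes \<theta> K t :: real
  assumes "\<theta> \<noteq> 0"
  shows "K * t - \<theta>\<^sup>2 * t\<^sup>2 \<le> K\<^sup>2 / (2 * \<theta>\<^sup>2) - (\<theta> / sqrt 2)\<^sup>2 * t\<^sup>2"
proof -
  have "0 \<le> (\<theta> * t - K / \<theta>)\<^sup>2" by simp
  also have "\<dots> = \<theta>\<^sup>2 * t\<^sup>2 - 2 * (K * t) + K\<^sup>2 / \<theta>\<^sup>2"
    using assms by (simp add: power2_diff power_mult_distrib power_divide)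
  finally show ?thesis by (simp add: power_divide)
qed

text \<open>
  The coefficient bound makes every partial sum at most \<open>C e^(K|x|)\<close> in norm, so dominated convergence
  applies with a wider Gaussian as the integrable majorant.
\<close>
lemma gaussian_integral_power_series:
  fixes \<theta> C K :: real and c :: "nat \<Rightarrow> complex" and h :: "real \<Rightarrow> complex"
  assumes "\<theta> \<noteq> 0" and "K \<ge> 0"
    and bound: "\<And>n. norm (c n) \<le> C * (K ^ n / fact n)"
    and h: "\<And>x. (\<lambda>n. c n * of_real x ^ n) sums h x"
  shows "integrable lborel (\<lambda>x. of_real (x ^ m * exp (- \<theta>\<^sup>2 * x\<^sup>2)) * h x)"
    and "(\<lambda>n. c n * of_real (LINT x|lborel. x ^ (m + n) * exp (- \<theta>\<^sup>2 * x\<^sup>2))) sums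
           (LINT x|lborel. of_real (x ^ m * exp (- \<theta>\<^sup>2 * x\<^sup>2)) * h x)"
proof -
  define f where "f x = of_real (x ^ m * exp (- \<theta>\<^sup>2 * x\<^sup>2)) * h x" for x
  define s where "s N x = of_real (x ^ m * exp (- \<theta>\<^sup>2 * x\<^sup>2)) * (\<Sum>n<N. c n * of_real x ^ n)" for N x
  define w where "w x = C * exp (K\<^sup>2 / (2 * \<theta>\<^sup>2)) * (\<bar>x\<bar> ^ m * exp (- (\<theta> / sqrt 2)\<^sup>2 * x\<^sup>2))" for x
  have "C \<ge> 0"
    using bound[of 0] order_trans[OF norm_ge_zero] by fastforce
  have lim: "(\<lambda>N. s N x) \<longlonglongrightarrow> f x" for x
    unfolding s_def f_def using h[of x] unfolding sums_def by (intro tendsto_intros)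
  have s_measurable [measurable]: "s N \<in> borel_measurable lborel" for N
    unfolding s_def by measurable
  have f_measurable [measurable]: "f \<in> borel_measurable lborel"
    by (rule borel_measurable_LIMSEQ_metric[OF s_measurable lim])
  have w_integrable: "integrable lborel w"
    unfolding w_def using assms(1) by (intro integrable_mult_right integrable_gaussian_abs_moment) auto
  have exp_split: "exp (a - b * c) = exp a * exp (- b * c)" for a b c :: real
    by (simp add: exp_diff exp_minus divide_inverse)
  have dom: "norm (s N x) \<le> w x" for N x
  proof -
    have "norm (\<Sum>n<N. c n * of_real x ^ n) \<le> (\<Sum>n<N. norm (c n * of_real x ^ n))"
      by (rule norm_sum)
    also have "\<dots> \<le> (\<Sum>n<N. C * ((K * \<bar>x\<bar>) ^ n / fact n))"
    proof (rule sum_mono)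
      fix n
      have "norm (c n) * \<bar>x\<bar> ^ n \<le> C * (K ^ n / fact n) * \<bar>x\<bar> ^ n"
        by (intro mult_right_mono bound) auto
      then show "norm (c n * of_real x ^ n) \<le> C * ((K * \<bar>x\<bar>) ^ n / fact n)"
        by (simp add: norm_mult norm_power power_mult_distrib)
    qed
    also have "\<dots> = C * (\<Sum>n<N. (K * \<bar>x\<bar>) ^ n / fact n)"
      by (simp add: sum_distrib_left)
    also have "(\<Sum>n<N. (K * \<bar>x\<bar>) ^ n / fact n) \<le> exp (K * \<bar>x\<bar>)"
      using \<open>K \<ge> 0\<close> exp_converges[of "K * \<bar>x\<bar>"]
      by (intro sum_le_suminf[of "\<lambda>n. (K * \<bar>x\<bar>) ^ n / fact n" "{..<N}", THEN order_trans])
         (auto simp: sums_iff divide_inverse mult.commute)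
    finally have "norm (\<Sum>n<N. c n * of_real x ^ n) \<le> C * exp (K * \<bar>x\<bar>)"
      using \<open>C \<ge> 0\<close> by (simp add: mult_left_mono)
    then have "norm (s N x) \<le> \<bar>x\<bar> ^ m * exp (- \<theta>\<^sup>2 * x\<^sup>2) * (C * exp (K * \<bar>x\<bar>))"
      unfolding s_def norm_mult by (intro mult_mono) (auto simp: norm_mult norm_power)
    also have "\<dots> = C * \<bar>x\<bar> ^ m * exp (K * \<bar>x\<bar> - \<theta>\<^sup>2 * \<bar>x\<bar>\<^sup>2)"
      by (simp only: exp_split power2_abs mult_ac)
    also have "\<dots> \<le> C * \<bar>x\<bar> ^ m * exp (K\<^sup>2 / (2 * \<theta>\<^sup>2) - (\<theta> / sqrt 2)\<^sup>2 * \<bar>x\<bar>\<^sup>2)"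
      using \<open>C \<ge> 0\<close> linear_le_gaussian_exponent[OF assms(1), of K "\<bar>x\<bar>"]
      by (intro mult_left_mono) auto
    also have "\<dots> = w x"
      by (simp only: w_def exp_split power2_abs mult_minus_left mult_minus_right mult_ac)
    finally show ?thesis .
  qed
  show "integrable lborel (\<lambda>x. of_real (x ^ m * exp (- \<theta>\<^sup>2 * x\<^sup>2)) * h x)"
    unfolding f_def[symmetric]
    by (rule integrable_dominated_convergence[where s = s and w = w])
       (use lim dom w_integrable in auto)
  have "(\<lambda>N. integral\<^sup>L lborel (s N)) \<longlonglongrightarrow> integral\<^sup>L lborel f"
    by (rule integral_dominated_convergence[where s = s and w = w])
       (use lim dom w_integrable in auto)
  moreover have "integral\<^sup>L lborel (s N) =
      (\<Sum>n<N. c n * of_real (LINT x|lborel. x ^ (m + n) * exp (- \<theta>\<^sup>2 * x\<^sup>2)))" for N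
  proof -
    have int: "integrable lborel (\<lambda>x. complex_of_real (x ^ (m + n) * exp (- \<theta>\<^sup>2 * x\<^sup>2)))" for n
      by (rule Bochner_Integration.integrable_bound[OF integrable_gaussian_abs_moment[OF assms(1), of "m + n"]])
         (auto simp: norm_mult norm_power abs_mult power_abs)
    have "s N = (\<lambda>x. \<Sum>n<N. c n * of_real (x ^ (m + n) * exp (- \<theta>\<^sup>2 * x\<^sup>2)))"
      unfolding s_def sum_distrib_left by (intro ext sum.cong) (simp_all add: power_add mult_ac)
    then show ?thesis
      using int by (simp only: Bochner_Integration.integral_sum integrable_mult_right integral_mult_right_zero
          integral_complex_of_real)
  qed
  ultimately show "(\<lambda>n. c n * of_real (LINT x|lborel. x ^ (m + n) * exp (- \<theta>\<^sup>2 * x\<^sup>2))) sums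
           (LINT x|lborel. of_real (x ^ m * exp (- \<theta>\<^sup>2 * x\<^sup>2)) * h x)"
    unfolding sums_def f_def[abs_def, symmetric] by simp
qed

text \<open>
  The shape required of the even coefficients is the part of a term of \<open>\<^sub>1F\<^sub>1\<close> that the
  Gaussian moments do not supply. The parameter \<open>b\<close> and the factor \<open>u\<close> are left open in order to serve both
  parities of \<open>\<alpha>\<close>: \<open>b = 1/2\<close>, \<open>u = 1\<close> for \<open>e\<^sup>i\<^sup>k\<^sup>x\<close>, and \<open>b = 3/2\<close>, \<open>u = ik\<close> for \<open>(e\<^sup>i\<^sup>k\<^sup>x - 1)/x\<close>.
\<close>
lemma gaussian_integral_eq_hyp1F1:
  fixes \<theta> C K k b :: real and c :: "nat \<Rightarrow> complex" and h :: "real \<Rightarrow> complex"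
  assumes "\<theta> \<noteq> 0" and "K \<ge> 0"
    and bound: "\<And>n. norm (c n) \<le> C * (K ^ n / fact n)"
    and h: "\<And>x. (\<lambda>n. c n * of_real x ^ n) sums h x"
    and c_even: "\<And>j. c (2 * j) = u * of_real ((- k\<^sup>2 / 4) ^ j / (pochhammer b j * fact j))"
  shows "has_bochner_integral lborel (\<lambda>x. of_real (x ^ (2 * p) * exp (- \<theta>\<^sup>2 * x\<^sup>2)) * h x)
           (u * of_real (Gamma (of_nat p + 1 / 2) / \<bar>\<theta>\<bar> ^ (2 * p + 1)
              * hyp1F1 (of_nat p + 1 / 2) b (- k\<^sup>2 / (4 * \<theta>\<^sup>2))))"
proof -
  define a where "a = real p + 1 / 2"
  define G where "G = Gamma a / \<bar>\<theta>\<bar> ^ (2 * p + 1)"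
  define r where "r j = pochhammer a j / pochhammer b j * ((- k\<^sup>2 / (4 * \<theta>\<^sup>2)) ^ j / fact j)" for j
  define I where "I = (LINT x|lborel. of_real (x ^ (2 * p) * exp (- \<theta>\<^sup>2 * x\<^sup>2)) * h x)"
  note series = gaussian_integral_power_series[where m = "2 * p", OF assms(1,2) bound h]
  have odd_moment: "(LINT x|lborel. x ^ (2 * p + n) * exp (- \<theta>\<^sup>2 * x\<^sup>2)) = 0" if "odd n" for n
    using that by (intro integral_odd_eq_0) simp
  have even_moment: "(LINT x|lborel. x ^ (2 * p + 2 * j) * exp (- \<theta>\<^sup>2 * x\<^sup>2)) =
      G * pochhammer a j / (\<theta>\<^sup>2) ^ j" for j
  proof -
    have "Gamma a \<noteq> 0" "a \<notin> \<int>\<^sub>\<le>\<^sub>0"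
      by (auto simp: a_def Gamma_eq_zero_iff elim!: nonpos_Ints_cases)
    then have "Gamma (a + real j) = Gamma a * pochhammer a j"
      by (simp add: pochhammer_Gamma)
    moreover have "(LINT x|lborel. x ^ (2 * (p + j)) * exp (- \<theta>\<^sup>2 * x\<^sup>2)) =
        Gamma (a + real j) / \<bar>\<theta>\<bar> ^ (2 * (p + j) + 1)"
      using has_bochner_integral_integral_eq[OF gaussian_moment_even[OF assms(1), of "p + j"]]
      by (simp add: a_def add_ac)
    moreover have "\<bar>\<theta>\<bar> ^ (2 * (p + j) + 1) = \<bar>\<theta>\<bar> ^ (2 * p + 1) * (\<theta>\<^sup>2) ^ j"
      by (simp add: power_add power_mult distrib_left)
    ultimately show ?thesis
      by (simp add: G_def distrib_left)
  qed
  have "(\<lambda>j. c (2 * j) * of_real (LINT x|lborel. x ^ (2 * p + 2 * j) * exp (- \<theta>\<^sup>2 * x\<^sup>2))) sums I"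
    unfolding I_def
    by (subst sums_mono_reindex[of "\<lambda>j. 2 * j"
          "\<lambda>n. c n * of_real (LINT x|lborel. x ^ (2 * p + n) * exp (- \<theta>\<^sup>2 * x\<^sup>2))"])
       (use series(2) odd_moment in \<open>auto simp: strict_mono_def elim!: evenE\<close>)
  also have "(\<lambda>j. c (2 * j) * of_real (LINT x|lborel. x ^ (2 * p + 2 * j) * exp (- \<theta>\<^sup>2 * x\<^sup>2))) =
      (\<lambda>j. (u * of_real G) * of_real (r j))"
  proof
    fix j
    have eq: "(- k\<^sup>2 / 4) ^ j / (\<theta>\<^sup>2) ^ j = (- k\<^sup>2 / (4 * \<theta>\<^sup>2)) ^ j"
      by (simp add: power_divide[symmetric])
    have "(- k\<^sup>2 / 4) ^ j / (pochhammer b j * fact j) * (G * pochhammer a j / (\<theta>\<^sup>2) ^ j) = G * r j"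
      unfolding r_def eq[symmetric] by (simp add: mult_ac)
    then show "c (2 * j) * of_real (LINT x|lborel. x ^ (2 * p + 2 * j) * exp (- \<theta>\<^sup>2 * x\<^sup>2)) =
        (u * of_real G) * of_real (r j)"
      unfolding c_even even_moment by (simp only: mult.assoc of_real_mult[symmetric])
  qed
  finally have sums: "(\<lambda>j. (u * of_real G) * of_real (r j)) sums I" .
  have "I = u * of_real (G * hyp1F1 a b (- k\<^sup>2 / (4 * \<theta>\<^sup>2)))"
    \<comment> \<open>Convergence of the hypergeometric series is read off from the convergent series of integrals;
      this needs a nonzero factor, and \<open>u = ik\<close> vanishes for \<open>k = 0\<close>.\<close>
  proof (cases "u * of_real G = 0")
    case True
    then show ?thesis using sums by (auto simp: sums_iff)
  next
    case False
    then have "summable (\<lambda>j. complex_of_real (r j))"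
      using sums by (auto simp: sums_iff summable_cmult_iff)
    then have "summable r" by (simp add: summable_of_real_iff)
    then have "(\<lambda>j. (u * of_real G) * of_real (r j)) sums ((u * of_real G) * of_real (\<Sum>j. r j))"
      by (intro sums_mult sums_of_real summable_sums)
    then show ?thesis
      using sums_unique2[OF sums] by (simp add: hyp1F1_def r_def)
  qed
  then show ?thesis
    using series(1) by (simp add: has_bochner_integral_iff I_def G_def a_def)
qed

section \<open>Principal values\<close>

text \<open>
  An odd summand, however singular at \<open>0\<close>, integrates to \<open>0\<close> over each symmetric cut-off set, and for
  the integrable summand the cut-off disappears in the limit by dominated convergence.
\<close>
lemma has_pv_integral_add_odd:
  fixes f g q :: "real \<Rightarrow> complex"
  assumes g: "has_bochner_integral lborel g I"
    and q_odd: "\<And>x. q (- x) = - q x"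
    and q_int: "\<And>\<epsilon>. \<epsilon> > 0 \<Longrightarrow> set_integrable lborel {x. \<epsilon> \<le> \<bar>x\<bar>} q"
    and f: "\<And>x. x \<noteq> 0 \<Longrightarrow> f x = g x + q x"
  shows "has_pv_integral f I"
proof -
  define A :: "real \<Rightarrow> real set" where "A \<epsilon> = {x. \<epsilon> \<le> \<bar>x\<bar>}" for \<epsilon>
  have A [measurable]: "A \<epsilon> \<in> sets lborel" for \<epsilon>
    unfolding A_def by measurable
  have g_int: "integrable lborel g" and g_eq: "integral\<^sup>L lborel g = I"
    using g by (auto simp: has_bochner_integral_iff)
  have [measurable]: "g \<in> borel_measurable lborel"
    using g_int by auto
  have g_set: "set_integrable lborel (A \<epsilon>) g" for \<epsilon>
    unfolding set_integrable_def by (rule integrable_mult_indicator[OF A g_int])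
  have f_eq: "(\<lambda>x. indicator (A \<epsilon>) x *\<^sub>R f x) = (\<lambda>x. indicator (A \<epsilon>) x *\<^sub>R (g x + q x))" if "\<epsilon> > 0" for \<epsilon>
    using that f by (auto simp: A_def indicator_def fun_eq_iff)
  have f_int: "set_integrable lborel (A \<epsilon>) f" if "\<epsilon> > 0" for \<epsilon>
    using set_integral_add(1)[OF g_set q_int[OF that, folded A_def]] f_eq[OF that]
    by (simp add: set_integrable_def)
  have f_val: "(LINT x:A \<epsilon>|lborel. f x) = (LINT x:A \<epsilon>|lborel. g x)" if "\<epsilon> > 0" for \<epsilon>
  proof -
    have "(LINT x:A \<epsilon>|lborel. q x) = 0"
      unfolding set_lebesgue_integral_def
      by (rule integral_odd_eq_0) (auto simp: A_def q_odd indicator_def)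
    then show ?thesis
      using set_integral_add(2)[OF g_set q_int[OF that, folded A_def]] f_eq[OF that]
      by (simp add: set_lebesgue_integral_def)
  qed
  have "((\<lambda>t. integral\<^sup>L lborel (\<lambda>x. indicator (A (inverse t)) x *\<^sub>R g x)) \<longlongrightarrow> integral\<^sup>L lborel g) at_top"
  proof (rule integral_dominated_convergence_at_top[where w = "\<lambda>x. norm (g x)"])
    have "((\<lambda>t. indicator (A (inverse t)) x *\<^sub>R g x) \<longlongrightarrow> g x) at_top" if "x \<noteq> 0" for x
    proof (rule tendsto_eventually)
      have "eventually (\<lambda>t. inverse \<bar>x\<bar> \<le> t) at_top"
        by (rule eventually_ge_at_top)
      then show "eventually (\<lambda>t. indicator (A (inverse t)) x *\<^sub>R g x = g x) at_top"
      proof eventually_elim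
        case (elim t)
        then have "inverse t \<le> \<bar>x\<bar>"
          using that le_imp_inverse_le[of "inverse \<bar>x\<bar>" t] by simp
        then show ?case by (simp add: A_def)
      qed
    qed
    then show "AE x in lborel. ((\<lambda>t. indicator (A (inverse t)) x *\<^sub>R g x) \<longlongrightarrow> g x) at_top"
      using AE_lborel_singleton[of "0::real"] by (auto elim: eventually_mono)
    show "\<forall>\<^sub>F t in at_top. AE x in lborel. norm (indicator (A (inverse t)) x *\<^sub>R g x) \<le> norm (g x)"
      by (auto simp: indicator_def)
  qed (use g_int in \<open>auto intro: integrable_norm\<close>)
  then have "((\<lambda>\<epsilon>. LINT x:A \<epsilon>|lborel. g x) \<longlongrightarrow> I) (at_right 0)"
    by (simp add: filterlim_at_right_to_top set_lebesgue_integral_def g_eq)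
  then have "((\<lambda>\<epsilon>. LINT x:A \<epsilon>|lborel. f x) \<longlongrightarrow> I) (at_right 0)"
    by (rule Lim_transform_eventually)
       (auto simp: f_val eventually_at_right_less intro: eventually_mono[OF eventually_at_right_less])
  then show ?thesis
    using f_int by (simp add: has_pv_integral_def A_def)
qed

section \<open>The two Fourier integrals\<close>

lemma fact_double_Suc:
  "fact (2 * j + 1) = (4 ^ j * pochhammer (3 / 2) j * fact j :: 'a :: field_char_0)"
  by (induction j) (simp_all add: pochhammer_rec' field_simps)

lemma fourier_even:
  fixes \<theta> k :: real
  assumes "\<theta> \<noteq> 0"
  shows "has_bochner_integral lborel (fourier_integrand (int (2 * p)) \<theta> k)
           (of_real (Gamma (of_nat p + 1 / 2) / \<bar>\<theta>\<bar> ^ (2 * p + 1)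
              * hyp1F1 (of_nat p + 1 / 2) (1 / 2) (- k\<^sup>2 / (4 * \<theta>\<^sup>2))))"
proof -
  define c where "c n = (\<i> * of_real k) ^ n / fact n" for n
  have h: "(\<lambda>n. c n * of_real x ^ n) sums exp (\<i> * of_real k * of_real x)" for x
    using exp_converges[of "\<i> * of_real k * of_real x"]
    by (simp add: c_def scaleR_conv_of_real power_mult_distrib field_simps)
  have c_even: "c (2 * j) = 1 * of_real ((- k\<^sup>2 / 4) ^ j / (pochhammer (1 / 2) j * fact j))" for j
  proof -
    have "(\<i> * complex_of_real k) ^ (2 * j) = of_real ((- k\<^sup>2) ^ j)"
      by (simp add: power_mult power_mult_distrib)
    moreover have "(fact (2 * j) :: real) = 4 ^ j * (pochhammer (1 / 2) j * fact j)"
      by (simp add: fact_double power_mult)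
    then have "(fact (2 * j) :: complex) = of_real (4 ^ j * (pochhammer (1 / 2) j * fact j))"
      by (metis of_real_fact)
    ultimately show ?thesis
      by (simp add: c_def power_divide power_minus[of "(complex_of_real k)\<^sup>2 / 4" j]
            power_minus[of "(complex_of_real k)\<^sup>2" j] del: fact_Suc)
  qed
  have "norm (c n) \<le> 1 * (\<bar>k\<bar> ^ n / fact n)" for n
    by (simp add: c_def norm_divide norm_mult norm_power)
  from gaussian_integral_eq_hyp1F1[OF assms abs_ge_zero this h c_even, of p]
  show ?thesis
    by (simp add: fourier_integrand_def[abs_def] del: of_nat_mult)
qed

text \<open>The value at \<open>0\<close> is the limit, which makes the function entire in \<open>x\<close>.\<close>
definition fourier_kernel_quotient :: "real \<Rightarrow> real \<Rightarrow> complex" where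
  "fourier_kernel_quotient k x =
     (if x = 0 then \<i> * of_real k else (exp (\<i> * of_real k * of_real x) - 1) / of_real x)"

text \<open>
  The power series of the quotient is the exponential series shifted by one index, so its even coefficients
  come from the odd terms \<open>(ik)^(2j+1)/(2j+1)!\<close>. This is the source of the factor \<open>ik\<close> and of the
  parameter \<open>3/2\<close>.
\<close>
lemma gaussian_fourier_kernel_quotient:
  fixes \<theta> k :: real
  assumes "\<theta> \<noteq> 0"
  shows "has_bochner_integral lborel
           (\<lambda>x. of_real (x ^ (2 * p) * exp (- \<theta>\<^sup>2 * x\<^sup>2)) * fourier_kernel_quotient k x)
           (\<i> * of_real (Gamma (of_nat p + 1 / 2) / \<bar>\<theta>\<bar> ^ (2 * p + 1) * k
              * hyp1F1 (of_nat p + 1 / 2) (3 / 2) (- k\<^sup>2 / (4 * \<theta>\<^sup>2))))"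
proof -
  define c where "c n = (\<i> * of_real k) ^ Suc n / fact (Suc n)" for n
  have h: "(\<lambda>n. c n * of_real x ^ n) sums fourier_kernel_quotient k x" for x
  proof (cases "x = 0")
    case True
    then show ?thesis
      using powser_sums_zero[of c] by (simp add: c_def fourier_kernel_quotient_def)
  next
    case False
    define z where "z = \<i> * of_real k * complex_of_real x"
    have "(\<lambda>n. z ^ Suc n / fact (Suc n)) sums (exp z - 1)"
      using exp_converges[of z] sums_Suc_iff[of "\<lambda>n. z ^ n / fact n" "exp z - 1"]
      by (simp add: scaleR_conv_of_real field_simps del: fact_Suc)
    then have "(\<lambda>n. z ^ Suc n / fact (Suc n) / of_real x) sums ((exp z - 1) / of_real x)"
      by (rule sums_divide)
    moreover have "z ^ Suc n / fact (Suc n) / of_real x = c n * of_real x ^ n" for n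
      using False by (simp add: z_def c_def power_mult_distrib del: fact_Suc)
    ultimately show ?thesis
      using False by (simp add: fourier_kernel_quotient_def z_def)
  qed
  have c_even: "c (2 * j) = (\<i> * of_real k) *
      of_real ((- k\<^sup>2 / 4) ^ j / (pochhammer (3 / 2) j * fact j))" for j
  proof -
    have "(\<i> * complex_of_real k) ^ (2 * j) = of_real ((- k\<^sup>2) ^ j)"
      by (simp add: power_mult power_mult_distrib)
    moreover have "(fact (Suc (2 * j)) :: complex) = of_real (4 ^ j * (pochhammer (3 / 2) j * fact j))"
      using fact_double_Suc[of j, where 'a = real]
      by (metis Suc_eq_plus1 mult.assoc of_real_fact)
    ultimately show ?thesis
      by (simp add: c_def power_divide power_minus[of "(complex_of_real k)\<^sup>2 / 4" j]
            power_minus[of "(complex_of_real k)\<^sup>2" j] del: fact_Suc)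
  qed
  have "norm (c n) \<le> \<bar>k\<bar> * (\<bar>k\<bar> ^ n / fact n)" for n
  proof -
    have "(fact n :: real) \<le> fact (Suc n)"
      by (rule fact_mono) simp
    then have "\<bar>k\<bar> ^ Suc n / fact (Suc n) \<le> \<bar>k\<bar> ^ Suc n / fact n"
      by (intro divide_left_mono) auto
    then show ?thesis
      by (simp add: c_def norm_divide norm_mult norm_power del: fact_Suc)
  qed
  from gaussian_integral_eq_hyp1F1[OF assms abs_ge_zero this h c_even, of p]
  show ?thesis
    by (simp add: mult_ac)
qed

text \<open>
  The odd remainder is written as \<open>x^(2p)/x\<close> because this form stays valid for \<open>p = 0\<close>. At \<open>x = 0\<close> and
  \<open>p = 0\<close> the identity itself fails for \<open>k \<noteq> 0\<close>: the convention \<open>1/0 = 0\<close> leaves \<open>ik\<close> on the right and \<open>0\<close> on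
  the left.
\<close>
lemma fourier_integrand_odd_split:
  assumes "x \<noteq> 0"
  shows "fourier_integrand (2 * int p - 1) \<theta> k x =
           of_real (x ^ (2 * p) * exp (- \<theta>\<^sup>2 * x\<^sup>2)) * fourier_kernel_quotient k x +
           of_real (x ^ (2 * p) * exp (- \<theta>\<^sup>2 * x\<^sup>2) / x)"
proof -
  have "x powi (2 * int p - 1) = x ^ (2 * p) / x"
    using assms power_int_of_nat[of x "2 * p"] by (simp add: power_int_diff)
  then have "fourier_integrand (2 * int p - 1) \<theta> k x =
      of_real (x ^ (2 * p) / x * exp (- \<theta>\<^sup>2 * x\<^sup>2)) * exp (\<i> * of_real k * of_real x)"
    by (simp add: fourier_integrand_def)
  then show ?thesis
    using assms by (simp add: fourier_kernel_quotient_def field_simps)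
qed

lemma fourier_odd_pv:
  fixes \<theta> k :: real
  assumes "\<theta> \<noteq> 0"
  shows "has_pv_integral (fourier_integrand (2 * int p - 1) \<theta> k)
           (\<i> * of_real (Gamma (of_nat p + 1 / 2) / \<bar>\<theta>\<bar> ^ (2 * p + 1) * k
              * hyp1F1 (of_nat p + 1 / 2) (3 / 2) (- k\<^sup>2 / (4 * \<theta>\<^sup>2))))"
proof (rule has_pv_integral_add_odd[OF gaussian_fourier_kernel_quotient[OF assms] _ _
      fourier_integrand_odd_split])
  fix \<epsilon> :: real assume "\<epsilon> > 0"
  let ?w = "\<lambda>x::real. x ^ (2 * p) * exp (- \<theta>\<^sup>2 * x\<^sup>2)"
  \<comment> \<open>Away from \<open>0\<close> the odd remainder is at most \<open>1/\<epsilon>\<close> times an even Gaussian moment integrand.\<close>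
  show "set_integrable lborel {x. \<epsilon> \<le> \<bar>x\<bar>} (\<lambda>x. complex_of_real (?w x / x))"
    unfolding set_integrable_def
  proof (rule Bochner_Integration.integrable_bound)
    show "integrable lborel (\<lambda>x. ?w x / \<epsilon>)"
      using integrable.intros[OF gaussian_moment_even[OF assms]] by simp
    have "norm (indicator {x. \<epsilon> \<le> \<bar>x\<bar>} x *\<^sub>R complex_of_real (?w x / x)) \<le> norm (?w x / \<epsilon>)" for x
    proof (cases "\<epsilon> \<le> \<bar>x\<bar>")
      case True
      then have "\<bar>?w x\<bar> / \<bar>x\<bar> \<le> \<bar>?w x\<bar> / \<epsilon>"
        using \<open>\<epsilon> > 0\<close> by (intro divide_left_mono) auto
      then show ?thesis
        using True \<open>\<epsilon> > 0\<close> by (simp only: norm_of_real norm_scaleR real_norm_def abs_divide) simp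
    qed (simp add: \<open>\<epsilon> > 0\<close>)
    then show "AE x in lborel. norm (indicator {x. \<epsilon> \<le> \<bar>x\<bar>} x *\<^sub>R complex_of_real (?w x / x))
        \<le> norm (?w x / \<epsilon>)"
      by simp
  qed measurable
qed simp_all

lemma fourier_odd:
  fixes \<theta> k :: real
  assumes "\<theta> \<noteq> 0" and "p > 0"
  shows "has_bochner_integral lborel (fourier_integrand (2 * int p - 1) \<theta> k)
           (\<i> * of_real (Gamma (of_nat p + 1 / 2) / \<bar>\<theta>\<bar> ^ (2 * p + 1) * k
              * hyp1F1 (of_nat p + 1 / 2) (3 / 2) (- k\<^sup>2 / (4 * \<theta>\<^sup>2))))"
proof -
  let ?q = "\<lambda>x::real. complex_of_real (x ^ (2 * p) * exp (- \<theta>\<^sup>2 * x\<^sup>2) / x)"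
  have abs_q: "norm (?q x) = \<bar>x\<bar> ^ (2 * p - 1) * exp (- \<theta>\<^sup>2 * x\<^sup>2)" for x
    using \<open>p > 0\<close> by (cases "x = 0") (auto simp: norm_divide norm_mult norm_power power_diff)
  have "integrable lborel ?q"
    by (rule Bochner_Integration.integrable_bound[OF integrable_gaussian_abs_moment[OF assms(1), of "2 * p - 1"]])
       (simp_all add: abs_q[simplified])
  moreover have "integral\<^sup>L lborel ?q = 0"
    by (rule integral_odd_eq_0) simp
  ultimately have q: "has_bochner_integral lborel ?q 0"
    by (simp add: has_bochner_integral_iff)
  have eq: "fourier_integrand (2 * int p - 1) \<theta> k x =
      of_real (x ^ (2 * p) * exp (- \<theta>\<^sup>2 * x\<^sup>2)) * fourier_kernel_quotient k x + ?q x" for x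
  proof (cases "x = 0")
    case True
    then show ?thesis using \<open>p > 0\<close> by (simp add: fourier_integrand_def)
  next
    case False
    then show ?thesis by (rule fourier_integrand_odd_split)
  qed
  show ?thesis
    using has_bochner_integral_add[OF gaussian_fourier_kernel_quotient[OF assms(1), of p k] q]
    by (simp add: eq[abs_def])
qed

theorem theorem7:
  fixes \<alpha> :: int and \<theta> k :: real
  assumes "\<theta> \<noteq> 0"
  shows "(\<alpha> > -1 \<and> even \<alpha> \<longrightarrow>
            has_bochner_integral lborel (fourier_integrand \<alpha> \<theta> k)
              (of_real (Gamma ((of_int \<alpha> + 1) / 2) / \<bar>\<theta>\<bar> powi (\<alpha> + 1)
                 * hyp1F1 ((of_int \<alpha> + 1) / 2) (1 / 2) (- k\<^sup>2 / (4 * \<theta>\<^sup>2)))))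
       \<and> (\<alpha> > -2 \<and> odd \<alpha> \<longrightarrow>
            has_pv_integral (fourier_integrand \<alpha> \<theta> k)
              (\<i> * of_real (Gamma (of_int \<alpha> / 2 + 1) / (\<theta>\<^sup>2 * \<bar>\<theta>\<bar> powi \<alpha>) * k
                 * hyp1F1 (of_int \<alpha> / 2 + 1) (3 / 2) (- k\<^sup>2 / (4 * \<theta>\<^sup>2)))))
       \<and> (\<alpha> > -1 \<and> odd \<alpha> \<longrightarrow>
            has_bochner_integral lborel (fourier_integrand \<alpha> \<theta> k)
              (\<i> * of_real (Gamma (of_int \<alpha> / 2 + 1) / (\<theta>\<^sup>2 * \<bar>\<theta>\<bar> powi \<alpha>) * k
                 * hyp1F1 (of_int \<alpha> / 2 + 1) (3 / 2) (- k\<^sup>2 / (4 * \<theta>\<^sup>2)))))"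
proof -
  have even: "has_bochner_integral lborel (fourier_integrand \<alpha> \<theta> k)
              (of_real (Gamma ((of_int \<alpha> + 1) / 2) / \<bar>\<theta>\<bar> powi (\<alpha> + 1)
                 * hyp1F1 ((of_int \<alpha> + 1) / 2) (1 / 2) (- k\<^sup>2 / (4 * \<theta>\<^sup>2))))"
    if "\<alpha> > -1" "even \<alpha>"
  proof -
    define p where "p = nat (\<alpha> div 2)"
    have \<alpha>: "\<alpha> = int (2 * p)"
      using that by (auto simp: p_def elim!: evenE)
    have "\<bar>\<theta>\<bar> powi (\<alpha> + 1) = \<bar>\<theta>\<bar> ^ (2 * p + 1)"
      using power_int_of_nat[of "\<bar>\<theta>\<bar>" "2 * p + 1"] by (simp add: \<alpha> add.commute)
    moreover have "(of_int \<alpha> + 1) / 2 = real p + 1 / 2"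
      by (simp add: \<alpha> field_simps)
    ultimately show ?thesis
      using fourier_even[OF assms, of p k] by (simp only: \<alpha>)
  qed
  have odd: "\<exists>p. \<alpha> = 2 * int p - 1 \<and> of_int \<alpha> / 2 + 1 = real p + 1 / 2 \<and>
      \<theta>\<^sup>2 * \<bar>\<theta>\<bar> powi \<alpha> = \<bar>\<theta>\<bar> ^ (2 * p + 1)" if "\<alpha> > -2" "odd \<alpha>"
  proof -
    define p where "p = nat ((\<alpha> + 1) div 2)"
    have \<alpha>: "\<alpha> = 2 * int p - 1"
      using that by (auto simp: p_def elim!: oddE)
    have "\<theta>\<^sup>2 * \<bar>\<theta>\<bar> powi \<alpha> = \<bar>\<theta>\<bar> powi (2 + \<alpha>)"
      using assms by (simp add: power_int_add)
    also have "2 + \<alpha> = int (2 * p + 1)"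
      by (simp add: \<alpha>)
    finally have "\<theta>\<^sup>2 * \<bar>\<theta>\<bar> powi \<alpha> = \<bar>\<theta>\<bar> ^ (2 * p + 1)"
      by (simp only: power_int_of_nat)
    moreover have "of_int \<alpha> / 2 + 1 = real p + 1 / 2"
      by (simp add: \<alpha> field_simps)
    ultimately show ?thesis
      using \<alpha> by blast
  qed
  have "has_pv_integral (fourier_integrand \<alpha> \<theta> k)
              (\<i> * of_real (Gamma (of_int \<alpha> / 2 + 1) / (\<theta>\<^sup>2 * \<bar>\<theta>\<bar> powi \<alpha>) * k
                 * hyp1F1 (of_int \<alpha> / 2 + 1) (3 / 2) (- k\<^sup>2 / (4 * \<theta>\<^sup>2))))"
    if "\<alpha> > -2" "odd \<alpha>"
  proof -
    from odd[OF that] obtain p where p: "\<alpha> = 2 * int p - 1"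
        "of_int \<alpha> / 2 + 1 = real p + 1 / 2" "\<theta>\<^sup>2 * \<bar>\<theta>\<bar> powi \<alpha> = \<bar>\<theta>\<bar> ^ (2 * p + 1)"
      by auto
    show ?thesis
      unfolding p(2,3) unfolding p(1) by (rule fourier_odd_pv[OF assms])
  qed
  moreover have "has_bochner_integral lborel (fourier_integrand \<alpha> \<theta> k)
              (\<i> * of_real (Gamma (of_int \<alpha> / 2 + 1) / (\<theta>\<^sup>2 * \<bar>\<theta>\<bar> powi \<alpha>) * k
                 * hyp1F1 (of_int \<alpha> / 2 + 1) (3 / 2) (- k\<^sup>2 / (4 * \<theta>\<^sup>2))))"
    if "\<alpha> > -1" "odd \<alpha>"
  proof -
    from that odd obtain p where p: "\<alpha> = 2 * int p - 1"
        "of_int \<alpha> / 2 + 1 = real p + 1 / 2" "\<theta>\<^sup>2 * \<bar>\<theta>\<bar> powi \<alpha> = \<bar>\<theta>\<bar> ^ (2 * p + 1)"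
      by auto
    then have "p > 0" using that by simp
    then show ?thesis
      unfolding p(2,3) unfolding p(1) by (rule fourier_odd[OF assms])
  qed
  ultimately show ?thesis
    using even by blast
qed

end
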